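(* If $h\le \frac{1-\beta}{\beta}\,w$, then the FIFO-optimality assumption (defined in the context) holds.
   Context: Model. A perishable product has a lifetime of $K$ periods; the horizon is $T$ periods; $\beta\in(0,1]$ is a discount factor. Demands $D_1,\dots,D_T\ge 0$ are exogenous random variables with finite means (possibly nonstationary and correlated). At the beginning of period $t$ one observes a realization $f_t$ of $F_t=(D_1,\dots,D_{t-1},U_1,\dots,U_t)$, where the $U_s$ are exogenous forecast information; the conditional joint law of $(D_t,\dots,D_T)$ given $f_t$ is known. The state also contains the inventory vector $\mathbf{x}_t=(x_{1,t},\dots,x_{K-1,t})$, $x_{k,t}\ge0$ being the inventory of age $k$. In period $t$ a quantity $q_t\ge0$ of age-0 product is ordered and arrives immediately; put $x_{0,t}=q_t$ and $y_t=\sum_{k=1}^{K-1}x_{k,t}+q_t$. Then $D_t$ occurs and is served oldest units first (FIFO), unmet demand is lost, all remaining units age by 1 and those reaching age $K$ are discarded (outdated): $X_{k,t+1}=\big(X_{k-1,t}-(D_t-\sum_{m=k}^{K-1}X_{m,t})^+\big)^+$, $k=1,\dots,K-1$, $t=1,\dots,T$. $p,h,w\ge0$ are the unit shortage, holding and outdating costs; there is no ordering cost. Optimal cost-to-go. $C_{T+1}\equiv0$ and $C_t(\mathbf{x}_t,f_t)=\min_{q_t\ge0}\{p\mathrm{E}[(D_t-y_t)^+|f_t]+h\mathrm{E}[(y_t-D_t)^+|f_t]+w\mathrm{E}[(x_{K-1,t}-D_t)^+|f_t]+\beta\mathrm{E}[C_{t+1}(\mathbf{X}_{t+1},F_{t+1})|f_t]\}$.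 "Implementing an optimal ordering policy" in a period means ordering, at the current state, a quantity attaining this minimum. FIFO-optimality assumption. Let $\Phi_t$ be the c.d.f. of $D_t$ conditioned on $f_t$, $\Phi_t^{-1}(z)=\inf\{x:\Phi_t(x)\ge z\}$, and $\bar y_t=\Phi_t^{-1}\big(\tfrac{p}{p+h}\big)$. An issuing policy is a collection of rules $(\mathbf{x}_t,f_t,q_t,d_t)\mapsto(v_{0,t},\dots,v_{K-1,t})$ with $0\le v_{k,t}\le x_{k,t}$ and $\sum_k v_{k,t}=\min\{y_t,d_t\}$ ($v_{k,t}$ units of age $k$ are used to meet demand; then $x_{k+1,t+1}=x_{k,t}-v_{k,t}$ for $0\le k\le K-2$, and $x_{K-1,t}-v_{K-1,t}$ units outdate). FIFO is $v_{k,t}=\min\{x_{k,t},(d_t-\sum_{m=k+1}^{K-1}x_{m,t})^+\}$. The assumption: for every $t$, starting from any state in period $t$ with $y_t\le\max_{\tau=1,\dots,t}\bar y_\tau$, if an optimal ordering policy is implemented in periods $t+1,\dots,T$, then FIFO minimizes the expected total (discounted shortage, holding and outdating) cost over periods $t,\dots,T$ among all issuing policies. *)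

theory Defs
  imports "HOL-Probability.Probability"
begin

text \<open>Stock levels, order quantities and demands live in \<open>[0, \<infinity>)\<close>.\<close>

abbreviation nonneg_borel :: "real measure" where
  "nonneg_borel \<equiv> restrict_space borel {0..}"

text \<open>
  A history in period \<open>t\<close> is a pair \<open>(d, u)\<close> of the demands \<open>d s\<close>, \<open>1 \<le> s < t\<close>, and the forecast
  information \<open>u s\<close>, \<open>1 \<le> s \<le> t\<close>.  The functions are \<open>undefined\<close> outside these index sets,
  as elements of a product space.
\<close>

type_synonym 'u history = "(nat \<Rightarrow> real) \<times> (nat \<Rightarrow> 'u)"

text \<open>
  An inventory vector \<open>x\<close> is indexed by the ages \<open>1, ..., K - 1\<close>.
  An ordering policy maps \<open>t x f\<close> to an order quantity; an issuing policy maps \<open>t x f q d k\<close> to the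
  number of units of age \<open>k\<close> that are used to meet the demand \<open>d\<close>.
\<close>

type_synonym inventory = "nat \<Rightarrow> real"
type_synonym 'u ordering = "nat \<Rightarrow> inventory \<Rightarrow> 'u history \<Rightarrow> real"
type_synonym 'u issuing = "nat \<Rightarrow> inventory \<Rightarrow> 'u history \<Rightarrow> real \<Rightarrow> real \<Rightarrow> nat \<Rightarrow> real"

definition history_space :: "(nat \<Rightarrow> 'u measure) \<Rightarrow> nat \<Rightarrow> 'u history measure" where
  "history_space N t = (\<Pi>\<^sub>M s\<in>{1..<t}. nonneg_borel) \<Otimes>\<^sub>M (\<Pi>\<^sub>M s\<in>{1..t}. N s)"

definition history_of ::
  "(nat \<Rightarrow> 'a \<Rightarrow> real) \<Rightarrow> (nat \<Rightarrow> 'a \<Rightarrow> 'u) \<Rightarrow> nat \<Rightarrow> 'a \<Rightarrow> 'u history" where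
  "history_of D U t \<omega> = ((\<lambda>s\<in>{1..<t}. D s \<omega>), (\<lambda>s\<in>{1..t}. U s \<omega>))"

definition history_upto :: "nat \<Rightarrow> 'u history \<Rightarrow> 'u history" where
  "history_upto t f = (restrict (fst f) {1..<t}, restrict (snd f) {1..t})"

definition extend :: "nat \<Rightarrow> 'u history \<Rightarrow> real \<times> 'u \<Rightarrow> 'u history" where
  "extend t f z = ((fst f)(t := fst z), (snd f)(Suc t := snd z))"

text \<open>
  The kernel \<open>\<kappa> t\<close> is a regular conditional law of \<open>(D t, U (t + 1))\<close> given \<open>F t\<close>; chaining these
  kernels yields the conditional law of all later demands and forecasts.  \<open>U (T + 1)\<close> completes the
  terminal history \<open>F (T + 1)\<close>; it has no influence on any cost and may be taken constant.
\<close>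

locale perishable_inventory = prob_space M
  for M :: "'a measure" +
  fixes N :: "nat \<Rightarrow> 'u measure"
    and K T :: nat
    and \<beta> p h w :: real
    and D :: "nat \<Rightarrow> 'a \<Rightarrow> real"
    and U :: "nat \<Rightarrow> 'a \<Rightarrow> 'u"
    and \<kappa> :: "nat \<Rightarrow> 'u history \<Rightarrow> (real \<times> 'u) measure"
  assumes lifetime: "1 \<le> K"
    and discount: "0 < \<beta>" "\<beta> \<le> 1"
    and unit_costs: "0 \<le> p" "0 \<le> h" "0 \<le> w"
    and demand_measurable: "\<And>t. t \<in> {1..T} \<Longrightarrow> D t \<in> M \<rightarrow>\<^sub>M nonneg_borel"
    and demand_finite_mean: "\<And>t. t \<in> {1..T} \<Longrightarrow> integrable M (D t)"
    and forecast_measurable: "\<And>t. t \<in> {1..Suc T} \<Longrightarrow> U t \<in> M \<rightarrow>\<^sub>M N t"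
    and kernel_measurable: "\<And>t. t \<in> {1..T} \<Longrightarrow>
      \<kappa> t \<in> history_space N t \<rightarrow>\<^sub>M prob_algebra (nonneg_borel \<Otimes>\<^sub>M N (Suc t))"
    and kernel_conditional_law: "\<And>t. t \<in> {1..T} \<Longrightarrow>
      distr M (history_space N t \<Otimes>\<^sub>M (nonneg_borel \<Otimes>\<^sub>M N (Suc t)))
        (\<lambda>\<omega>. (history_of D U t \<omega>, (D t \<omega>, U (Suc t) \<omega>))) =
      distr M (history_space N t) (history_of D U t) \<bind>
        (\<lambda>f. \<kappa> t f \<bind>
          (\<lambda>z. return (history_space N t \<Otimes>\<^sub>M (nonneg_borel \<Otimes>\<^sub>M N (Suc t))) (f, z)))"
begin

abbreviation hist :: "nat \<Rightarrow> 'u history measure" where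
  "hist t \<equiv> history_space N t"

definition inventories :: "inventory measure" where
  "inventories = (\<Pi>\<^sub>M k\<in>{1..<K}. nonneg_borel)"

definition stock :: "inventory \<Rightarrow> real \<Rightarrow> nat \<Rightarrow> real" where
  "stock x q = x(0 := q)"

definition available :: "inventory \<Rightarrow> real \<Rightarrow> real" where
  "available x q = (\<Sum>k\<in>{1..<K}. x k) + q"

definition fifo_next :: "inventory \<Rightarrow> real \<Rightarrow> real \<Rightarrow> inventory" where
  "fifo_next x q d =
    (\<lambda>k\<in>{1..<K}. max 0 (stock x q (k - 1) - max 0 (d - (\<Sum>m\<in>{k..<K}. stock x q m))))"

text \<open>
  Costs are nonnegative, so conditional expectations given \<open>f\<close> are integrals with values in
  \<open>[0, \<infinity>]\<close> with respect to \<open>\<kappa> t f\<close>.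
\<close>

definition order_cost ::
  "nat \<Rightarrow> (inventory \<Rightarrow> 'u history \<Rightarrow> ennreal) \<Rightarrow> inventory \<Rightarrow> 'u history \<Rightarrow> real \<Rightarrow> ennreal" where
  "order_cost t V x f q =
     ennreal p * (\<integral>\<^sup>+(d, u). ennreal (max 0 (d - available x q)) \<partial>\<kappa> t f)
   + ennreal h * (\<integral>\<^sup>+(d, u). ennreal (max 0 (available x q - d)) \<partial>\<kappa> t f)
   + ennreal w * (\<integral>\<^sup>+(d, u). ennreal (max 0 (stock x q (K - 1) - d)) \<partial>\<kappa> t f)
   + ennreal \<beta> * (\<integral>\<^sup>+(d, u). V (fifo_next x q d) (extend t f (d, u)) \<partial>\<kappa> t f)"

function optimal_cost :: "nat \<Rightarrow> inventory \<Rightarrow> 'u history \<Rightarrow> ennreal" where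
  "optimal_cost t x f =
    (if T < t then 0
     else INF q\<in>{0..}. order_cost t (\<lambda>x' f'. optimal_cost (Suc t) x' f') x f q)"
  by pat_completeness auto
termination
  by (relation "Wellfounded.measure (\<lambda>(t, x, f). Suc T - t)") auto

declare optimal_cost.simps [simp del]

definition optimal_order :: "nat \<Rightarrow> inventory \<Rightarrow> 'u history \<Rightarrow> real \<Rightarrow> bool" where
  "optimal_order t x f q \<longleftrightarrow>
     0 \<le> q \<and> order_cost t (optimal_cost (Suc t)) x f q = optimal_cost t x f"

text \<open>Policies are measurable, so that the expected costs they incur are meaningful.\<close>

definition optimal_ordering_from :: "nat \<Rightarrow> 'u ordering \<Rightarrow> bool" where
  "optimal_ordering_from t0 ord \<longleftrightarrow>
    (\<forall>t\<in>{t0..T}.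
       (\<lambda>(x, f). ord t x f) \<in> borel_measurable (inventories \<Otimes>\<^sub>M hist t) \<and>
       (\<forall>x\<in>space inventories. \<forall>f\<in>space (hist t). optimal_order t x f (ord t x f)))"

definition issuing_policy :: "'u issuing \<Rightarrow> bool" where
  "issuing_policy v \<longleftrightarrow>
    (\<forall>t\<in>{1..T}.
       (\<forall>k<K. (\<lambda>(x, f, q, d). v t x f q d k)
          \<in> borel_measurable (inventories \<Otimes>\<^sub>M hist t \<Otimes>\<^sub>M nonneg_borel \<Otimes>\<^sub>M nonneg_borel)) \<and>
       (\<forall>x\<in>space inventories. \<forall>f\<in>space (hist t). \<forall>q\<ge>0. \<forall>d\<ge>0.
          (\<forall>k<K. 0 \<le> v t x f q d k \<and> v t x f q d k \<le> stock x q k) \<and>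
          (\<Sum>k<K. v t x f q d k) = min (available x q) d))"

definition fifo :: "'u issuing" where
  "fifo t x f q d k = min (stock x q k) (max 0 (d - (\<Sum>m\<in>{Suc k..<K}. stock x q m)))"

definition issue_next :: "(nat \<Rightarrow> real) \<Rightarrow> inventory \<Rightarrow> real \<Rightarrow> inventory" where
  "issue_next v x q = (\<lambda>k\<in>{1..<K}. stock x q (k - 1) - v (k - 1))"

text \<open>
  \<open>trajectory ord v t x q g n\<close> is the pair of inventory vector and order quantity in period \<open>t + n\<close>,
  on the sample path \<open>g\<close>, when period \<open>t\<close> starts with inventory \<open>x\<close> and order \<open>q\<close> and \<open>ord\<close> governs
  the orders from period \<open>t + 1\<close> on.
\<close>

primrec trajectory ::
  "'u ordering \<Rightarrow> 'u issuing \<Rightarrow> nat \<Rightarrow> inventory \<Rightarrow> real \<Rightarrow> 'u history \<Rightarrow> nat \<Rightarrow> inventory \<times> real" where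
  "trajectory ord v t x q g 0 = (x, q)"
| "trajectory ord v t x q g (Suc n) =
    (let s = t + n;
         (x', q') = trajectory ord v t x q g n;
         x'' = issue_next (v s x' (history_upto s g) q' (fst g s)) x' q'
     in (x'', ord (Suc s) x'' (history_upto (Suc s) g)))"

definition period_cost ::
  "'u issuing \<Rightarrow> nat \<Rightarrow> 'u history \<Rightarrow> inventory \<times> real \<Rightarrow> real" where
  "period_cost v s g = (\<lambda>(x, q).
     p * max 0 (fst g s - available x q)
   + h * max 0 (available x q - fst g s)
   + w * (stock x q (K - 1) - v s x (history_upto s g) q (fst g s) (K - 1)))"

definition total_cost ::
  "'u ordering \<Rightarrow> 'u issuing \<Rightarrow> nat \<Rightarrow> inventory \<Rightarrow> real \<Rightarrow> 'u history \<Rightarrow> real" where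
  "total_cost ord v t x q g =
    (\<Sum>s\<in>{t..T}. \<beta> ^ (s - t) * period_cost v s g (trajectory ord v t x q g (s - t)))"

text \<open>Conditional law of the complete history \<open>F (T + 1)\<close> given that \<open>F t\<close> equals \<open>f\<close>.\<close>

function path_law :: "nat \<Rightarrow> 'u history \<Rightarrow> 'u history measure" where
  "path_law t f =
    (if T < t then return (hist (Suc T)) f
     else \<kappa> t f \<bind> (\<lambda>z. path_law (Suc t) (extend t f z)))"
  by pat_completeness auto
termination
  by (relation "Wellfounded.measure (\<lambda>(t, f). Suc T - t)") auto

declare path_law.simps [simp del]

definition expected_total_cost ::
  "'u ordering \<Rightarrow> nat \<Rightarrow> inventory \<Rightarrow> 'u history \<Rightarrow> real \<Rightarrow> 'u issuing \<Rightarrow> ennreal" where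
  "expected_total_cost ord t x f q v =
    (\<integral>\<^sup>+g. ennreal (total_cost ord v t x q g) \<partial>path_law t f)"

definition demand_cdf :: "nat \<Rightarrow> 'u history \<Rightarrow> real \<Rightarrow> real" where
  "demand_cdf t f x = measure (\<kappa> t f) {z \<in> space (\<kappa> t f). fst z \<le> x}"

text \<open>
  The quantile ranges over \<open>[0, \<infinity>)\<close>, where demand lives; it is \<open>\<infinity>\<close> if no level attains the
  critical ratio.
\<close>

definition critical_level :: "nat \<Rightarrow> 'u history \<Rightarrow> ereal" where
  "critical_level t f = Inf {ereal x |x. 0 \<le> x \<and> p / (p + h) \<le> demand_cdf t f x}"

definition fifo_optimality :: bool where
  "fifo_optimality \<longleftrightarrow>
    (\<forall>t\<in>{1..T}. \<forall>x\<in>space inventories. \<forall>f\<in>space (hist t). \<forall>q\<ge>0.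
       ereal (available x q) \<le> (MAX \<tau>\<in>{1..t}. critical_level \<tau> (history_upto \<tau> f)) \<longrightarrow>
       (\<forall>ord. optimal_ordering_from (Suc t) ord \<longrightarrow>
          is_arg_min (expected_total_cost ord t x f q) issuing_policy fifo))"

end

end

theory Submission
  imports Defs
begin

text \<open>
  Order the inventory vectors by their youngest-first partial sums.  For a fixed order quantity, FIFO
  maps them to \<open>min\<close> of the shifted partial sum and the total remaining stock, so it preserves this
  order, and the state it produces dominates the state after any other way of issuing; the excess
  in total stock is exactly the difference in outdated units.  By the hypothesis
  \<open>\<beta> (h + w) \<le> w\<close>: holding a unit for one more period and outdating it then costs at most as much as
  outdating it now.  Hence, by backward induction, \<open>\<beta>\<close> times the optimal cost-to-go increases by at
  most \<open>w\<close> per unit of excess stock when passing to a dominating state, which is what FIFO saves in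
  outdating costs.  A second backward induction along the sample path compares an arbitrary issuing
  policy with the optimal cost-to-go, which FIFO attains.
\<close>

context perishable_inventory
begin

section \<open>One-period costs and the dominance order on inventories\<close>

definition stage_cost :: "inventory \<Rightarrow> real \<Rightarrow> real \<Rightarrow> real" where
  "stage_cost x q d =
     p * max 0 (d - available x q) + h * max 0 (available x q - d)
   + w * max 0 (stock x q (K - 1) - d)"

definition total :: "inventory \<Rightarrow> real" where
  "total x = (\<Sum>k\<in>{1..<K}. x k)"

text \<open>Dominance of youngest-first partial sums. The totals may differ:
  \<open>j = K - 1\<close> gives \<open>total x' \<le> total x\<close>, and this excess of total
  stock is the quantity that all cost comparisons are charged against.\<close>

definition younger :: "inventory \<Rightarrow> inventory \<Rightarrow> bool" where
  "younger x x' \<longleftrightarrow> (\<forall>j<K. (\<Sum>k\<in>{1..<Suc j}. x' k) \<le> (\<Sum>k\<in>{1..<Suc j}. x k))"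

lemma sum_stock_Suc: "(\<Sum>k<Suc j. stock x q k) = q + (\<Sum>k\<in>{1..<Suc j}. x k)"
proof -
  have "{..<Suc j} = insert 0 {1..<Suc j}" by auto
  then show ?thesis by (simp add: stock_def)
qed

lemma available_eq_sum_stock: "available x q = (\<Sum>k<K. stock x q k)"
  using sum_stock_Suc[of x q "K - 1"] lifetime by (simp add: available_def)

lemma available_eq_total: "available x q = total x + q"
  by (simp add: available_def total_def)

lemma inventories_nonneg: "x \<in> space inventories \<Longrightarrow> k \<in> {1..<K} \<Longrightarrow> 0 \<le> x k"
  by (auto simp: inventories_def space_PiM space_restrict_space PiE_iff)

lemma stock_nonneg: "x \<in> space inventories \<Longrightarrow> 0 \<le> q \<Longrightarrow> k < K \<Longrightarrow> 0 \<le> stock x q k"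
  using inventories_nonneg[of x k] by (simp add: stock_def)

lemma available_nonneg: "x \<in> space inventories \<Longrightarrow> 0 \<le> q \<Longrightarrow> 0 \<le> available x q"
  unfolding available_eq_sum_stock by (intro sum_nonneg) (auto intro: stock_nonneg)

lemma younger_total: "younger x x' \<Longrightarrow> total x' \<le> total x"
  using lifetime unfolding younger_def total_def
  by (metis Suc_pred' diff_less less_le_trans zero_less_one)

lemma younger_stock:
  assumes "younger x x'" "j \<le> K"
  shows "(\<Sum>k<j. stock x' q k) \<le> (\<Sum>k<j. stock x q k)"
proof (cases j)
  case (Suc i)
  then show ?thesis using assms by (simp only: sum_stock_Suc younger_def) auto
qed simp

text \<open>FIFO draws from the old end, so the youngest \<open>j\<close> age classes stay untouched
  until all older ones are exhausted. What is left of them is therefore capped only by the total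
  leftover stock.\<close>

lemma sum_fifo_remaining:
  assumes nn: "\<And>k. k < K \<Longrightarrow> 0 \<le> stock x q k" and "j \<le> K"
  shows "(\<Sum>k<j. stock x q k - fifo t x f q d k) =
    min (\<Sum>k<j. stock x q k) (max 0 (available x q - d))"
  using \<open>j \<le> K\<close>
proof (induction j)
  case 0
  then show ?case by simp
next
  case (Suc j)
  have *: "available x q
      = (\<Sum>k<j. stock x q k) + stock x q j + (\<Sum>k\<in>{Suc j..<K}. stock x q k)"
    using Suc.prems sum.atLeastLessThan_concat[of 0 j K "stock x q"]
      sum.atLeast_Suc_lessThan[of j K "stock x q"]
    by (simp add: available_eq_sum_stock lessThan_atLeast0)
  have nn': "0 \<le> (\<Sum>k<j. stock x q k)" "0 \<le> stock x q j"
    using Suc.prems nn by (auto intro!: sum_nonneg)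
  \<comment> \<open>Here \<open>a\<close> is the stock younger than age \<open>j\<close>,
    \<open>b\<close> the stock of age \<open>j\<close> and \<open>c\<close> the older stock, which
    is used before \<open>b\<close>.\<close>
  have step: "min a (max 0 (a + b + c - d)) + (b - min b (max 0 (d - c)))
      = min (a + b) (max 0 (a + b + c - d))" if "0 \<le> a" "0 \<le> b" for a b c :: real
    using that by linarith
  have "(\<Sum>k<Suc j. stock x q k - fifo t x f q d k)
    = min (\<Sum>k<j. stock x q k) (max 0 (available x q - d)) + (stock x q j - fifo t x f q d j)"
    using Suc by simp
  also have "\<dots> = min ((\<Sum>k<j. stock x q k) + stock x q j) (max 0 (available x q - d))"
    unfolding * fifo_def by (rule step[OF nn'])
  finally show ?case by simp
qed

lemma sum_fifo:
  assumes "x \<in> space inventories" "0 \<le> q" "0 \<le> d"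
  shows "(\<Sum>k<K. fifo t x f q d k) = min (available x q) d"
proof -
  \<comment> \<open>This is the remaining stock for \<open>j = K\<close>; it is solved for the
    issued quantity below.\<close>
  have "available x q - (\<Sum>k<K. fifo t x f q d k)
      = min (available x q) (max 0 (available x q - d))"
    using sum_fifo_remaining[of x q K t f d] stock_nonneg[OF assms(1,2)]
    by (simp add: sum_subtractf available_eq_sum_stock)
  moreover have "s = min y d" if "y - s = min y (max 0 (y - d))" "0 \<le> y" for s y :: real
    using that assms(3) by linarith
  ultimately show ?thesis using available_nonneg[OF assms(1,2)] by blast
qed

lemma fifo_oldest: "0 \<le> d \<Longrightarrow>
  stock x q (K - 1) - fifo t x f q d (K - 1) = max 0 (stock x q (K - 1) - d)"
  using lifetime by (auto simp: fifo_def)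

text \<open>The identity \<open>a - min a b = max 0 (a - b)\<close> turns the FIFO rule into the
  recursion for the next inventory. Period and history do not enter \<open>fifo\<close>, so later
  uses may supply the dummy values \<open>0\<close> and \<open>undefined\<close>.\<close>

lemma fifo_next_eq_issue_next: "fifo_next x q d = issue_next (fifo t x f q d) x q"
  unfolding fifo_next_def issue_next_def
  by (intro restrict_ext) (auto simp: fifo_def min_def max_def)

lemma sum_issue_next:
  assumes "j < K"
  shows "(\<Sum>k\<in>{1..<Suc j}. issue_next v x q k) = (\<Sum>k<j. stock x q k - v k)"
proof -
  have "(\<Sum>k\<in>{1..<Suc j}. issue_next v x q k) = (\<Sum>k\<in>{Suc 0..<Suc j}. stock x q (k - 1) - v (k - 1))"
    using assms by (intro sum.cong) (auto simp: issue_next_def)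
  also have "\<dots> = (\<Sum>k\<in>{0..<j}. stock x q k - v k)"
    by (subst sum.shift_bounds_Suc_ivl) simp
  finally show ?thesis by (simp add: lessThan_atLeast0)
qed

lemma sum_fifo_next:
  assumes "\<And>k. k < K \<Longrightarrow> 0 \<le> stock x q k" "j < K"
  shows "(\<Sum>k\<in>{1..<Suc j}. fifo_next x q d k) =
    min (\<Sum>k<j. stock x q k) (max 0 (available x q - d))"
  unfolding fifo_next_eq_issue_next[of x q d 0 undefined] using assms
  by (simp only: sum_issue_next) (simp add: sum_fifo_remaining)

text \<open>Conservation of units: of the stock left after the demand, whatever is not carried over
  outdates. Two rules applied in the same state thus differ in outdating by exactly the difference
  between the totals they carry over.\<close>

lemma outdated_eq:
  assumes "(\<Sum>k<K. v k) = min (available x q) d"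
  shows "stock x q (K - 1) - v (K - 1) = max 0 (available x q - d) - total (issue_next v x q)"
proof -
  obtain K' where K': "K - 1 = K'" "K = Suc K'" using lifetime by (cases K) auto
  have 1: "total (issue_next v x q) = (\<Sum>k<K'. stock x q k) - (\<Sum>k<K'. v k)"
    unfolding total_def sum_subtractf[symmetric]
    using sum_issue_next[of K' v x q] K'(2)[symmetric] by (metis lessI)
  have 2: "available x q = (\<Sum>k<K'. stock x q k) + stock x q K'"
    unfolding available_eq_sum_stock using K' by (metis sum.lessThan_Suc)
  have 3: "(\<Sum>k<K'. v k) + v K' = min (available x q) d" using assms K'(2) by simp
  have "b - v' = max 0 (y - d) - (a - a')" if "y = a + b" "a' + v' = min y d"
    for a a' b v' y :: real
    using that by linarith
  from this[OF 2 3] show ?thesis unfolding 1 K'(1) .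
qed

text \<open>By conservation of units, outdating costs \<open>w\<close> on all leftover stock minus a
  credit of \<open>w\<close> for the stock carried over. This trades the oldest age class, which
  dominance alone does not order, for totals, which it does.\<close>

lemma stage_cost_eq:
  assumes "x \<in> space inventories" "0 \<le> q" "0 \<le> d"
  shows "stage_cost x q d = p * max 0 (d - available x q) + (h + w) * max 0 (available x q - d)
    - w * total (fifo_next x q d)"
proof -
  have "max 0 (stock x q (K - 1) - d) = max 0 (available x q - d) - total (fifo_next x q d)"
    using outdated_eq[OF sum_fifo[OF assms], of 0 undefined]
      fifo_oldest[OF assms(3)]
    by (simp add: fifo_next_eq_issue_next[of x q d 0 undefined])
  moreover have "a + h * m + w * (m - n) = a + (h + w) * m - w * n" for a m n :: real
    by (simp add: algebra_simps)
  ultimately show ?thesis unfolding stage_cost_def by (simp only:)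
qed

lemma stage_cost_nonneg: "0 \<le> stage_cost x q d"
  unfolding stage_cost_def using unit_costs by auto

text \<open>Both arguments of the minimum in \<open>sum_fifo_next\<close>, a partial sum of the
  stock and the total leftover stock, are monotone with respect to dominance.\<close>

lemma younger_fifo_next:
  assumes "younger x x'" "x \<in> space inventories" "x' \<in> space inventories" "0 \<le> q"
  shows "younger (fifo_next x q d) (fifo_next x' q d)"
  unfolding younger_def
proof (intro allI impI)
  fix j assume "j < K"
  moreover have "available x' q \<le> available x q"
    using younger_total[OF assms(1)] by (simp add: available_eq_total)
  ultimately show "(\<Sum>k\<in>{1..<Suc j}. fifo_next x' q d k) \<le> (\<Sum>k\<in>{1..<Suc j}. fifo_next x q d k)"
    using younger_stock[OF assms(1), of j q] assms(2-4)
    by (simp only: sum_fifo_next stock_nonneg) (intro min.mono max.mono; simp)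
qed

text \<open>The added term cancels the credits for stock carried over. Of the rest, the shortage
  cost falls as stock grows, and the leftover stock grows by at most the excess of \<open>x\<close>,
  at a cost of \<open>h + w\<close> per unit. The hypothesis bounds this by
  \<open>w / \<beta>\<close>, which is the rate that the backward induction has to
  reproduce.\<close>

lemma younger_stage_cost:
  assumes "younger x x'" "x \<in> space inventories" "x' \<in> space inventories" "0 \<le> q" "0 \<le> d"
    and hw: "h + w \<le> w / \<beta>"
  shows "stage_cost x q d + w * (total (fifo_next x q d) - total (fifo_next x' q d))
    \<le> stage_cost x' q d + w / \<beta> * (total x - total x')"
proof -
  let ?y = "available x q" and ?y' = "available x' q"
  have tot: "total x' \<le> total x" by (rule younger_total) fact
  have y: "?y - ?y' = total x - total x'" by (simp add: available_eq_total)
  have 1: "p * max 0 (d - ?y) \<le> p * max 0 (d - ?y')"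
    using tot y unit_costs by (intro mult_left_mono) auto
  have 2: "(h + w) * (max 0 (?y - d) - max 0 (?y' - d)) \<le> (h + w) * (total x - total x')"
    using tot y unit_costs by (intro mult_left_mono) auto
  have 3: "(h + w) * (total x - total x') \<le> w / \<beta> * (total x - total x')"
    using tot hw by (intro mult_right_mono) auto
  have eq: "stage_cost z q d = p * max 0 (d - available z q)
      + (h + w) * max 0 (available z q - d) - w * total (fifo_next z q d)"
    if "z \<in> space inventories" for z
    using that assms(4,5) by (rule stage_cost_eq)
  have lin: "p * a + (h + w) * m - w * n + w * (n - n') \<le> p * a' + (h + w) * m' - w * n' + r"
    if "p * a \<le> p * a'" "(h + w) * (m - m') \<le> s" "s \<le> r" for a a' m m' n n' r s :: real
    using that by (simp add: algebra_simps)
  show ?thesis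
    unfolding eq[OF assms(2)] eq[OF assms(3)] by (rule lin[OF 1 2 3])
qed

text \<open>Under any rule the youngest \<open>j\<close> classes keep at most what they held and at
  most the total leftover stock. FIFO attains the smaller of these two bounds for every
  \<open>j\<close> at once.\<close>

lemma fifo_next_younger_issue_next:
  assumes "x \<in> space inventories" "0 \<le> q"
    and v: "\<And>k. k < K \<Longrightarrow> 0 \<le> v k \<and> v k \<le> stock x q k" "(\<Sum>k<K. v k) = min (available x q) d"
  shows "younger (fifo_next x q d) (issue_next v x q)"
  unfolding younger_def
proof (intro allI impI)
  fix j assume j: "j < K"
  have "(\<Sum>k<j. stock x q k - v k) \<le> (\<Sum>k<K. stock x q k - v k)"
    using j v(1) by (intro sum_mono2) auto
  also have "\<dots> = max 0 (available x q - d)"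
    by (simp add: sum_subtractf v(2) available_eq_sum_stock[symmetric] min_def max_def)
  finally have "(\<Sum>k<j. stock x q k - v k) \<le> max 0 (available x q - d)" .
  moreover have "(\<Sum>k<j. stock x q k - v k) \<le> (\<Sum>k<j. stock x q k)"
    using j v(1) by (intro sum_mono) auto
  ultimately show "(\<Sum>k\<in>{1..<Suc j}. issue_next v x q k) \<le> (\<Sum>k\<in>{1..<Suc j}. fifo_next x q d k)"
    using j assms by (simp only: sum_fifo_next sum_issue_next stock_nonneg)
qed

text \<open>Conservation of units is applied to both rules: what \<open>v\<close> outdates beyond
  FIFO is the stock that FIFO carries over beyond \<open>v\<close>. The right-hand side is the
  one-period cost of \<open>v\<close>.\<close>

lemma stage_cost_plus_excess:
  assumes "x \<in> space inventories" "0 \<le> q" "0 \<le> d" "(\<Sum>k<K. v k) = min (available x q) d"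
  shows "stage_cost x q d + w * (total (fifo_next x q d) - total (issue_next v x q))
    = p * max 0 (d - available x q) + h * max 0 (available x q - d)
      + w * (stock x q (K - 1) - v (K - 1))"
proof -
  have "a + (h + w) * m - w * n + w * (n - n') = a + h * m + w * (m - n')" for a m n n' :: real
    by (simp add: algebra_simps)
  then show ?thesis
    unfolding stage_cost_eq[OF assms(1-3)] outdated_eq[OF assms(4)] .
qed

section \<open>Measurability of histories and of the one-period dynamics\<close>

lemma space_hist:
  "f \<in> space (hist t) \<longleftrightarrow>
    fst f \<in> (\<Pi>\<^sub>E s\<in>{1..<t}. {0..}) \<and> snd f \<in> (\<Pi>\<^sub>E s\<in>{1..t}. space (N s))"
  by (cases f) (simp add: history_space_def space_pair_measure space_PiM space_restrict_space)

lemma demand_measurable_hist: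
  "s \<in> {1..<t} \<Longrightarrow> (\<lambda>g. fst g s) \<in> hist t \<rightarrow>\<^sub>M nonneg_borel"
  unfolding history_space_def by measurable

lemma history_upto_measurable: "s \<le> t \<Longrightarrow> history_upto s \<in> hist t \<rightarrow>\<^sub>M hist s"
  unfolding history_upto_def history_space_def
  by (intro measurable_Pair measurable_restrict measurable_compose[OF measurable_fst]
      measurable_compose[OF measurable_snd] measurable_component_singleton) auto

lemma history_upto_ident: "f \<in> space (hist t) \<Longrightarrow> history_upto t f = f"
  by (cases f) (auto simp: history_upto_def space_hist)

lemma history_upto_upto: "s \<le> t \<Longrightarrow> history_upto s (history_upto t f) = history_upto s f"
  by (auto simp: history_upto_def Int_absorb1 intro!: restrict_ext arg_cong[of _ _ "restrict _"])

lemma history_upto_extend: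
  assumes "f \<in> space (hist t)" shows "history_upto t (extend t f z) = f"
proof -
  have "restrict ((fst f)(t := fst z)) {1..<t} = restrict (fst f) {1..<t}"
    "restrict ((snd f)(Suc t := snd z)) {1..t} = restrict (snd f) {1..t}"
    by (intro restrict_ext; simp)+
  then show ?thesis
    using history_upto_ident[OF assms] by (simp add: history_upto_def extend_def)
qed

lemma extend_measurable:
  assumes "1 \<le> t"
  shows "(\<lambda>(f, z). extend t f z) \<in> hist t \<Otimes>\<^sub>M (nonneg_borel \<Otimes>\<^sub>M N (Suc t)) \<rightarrow>\<^sub>M hist (Suc t)"
proof -
  \<comment> \<open>The assumption \<open>1 \<le> t\<close> places the index \<open>t\<close> of the
    new demand in \<open>{1..<Suc t}\<close>; for \<open>t = 0\<close> the first equation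
    fails.\<close>
  have 1: "{1..<Suc t} = {1..<t} \<union> {t}" "{1..Suc t} = {1..t} \<union> {Suc t}" using assms by auto
  show ?thesis
    unfolding history_space_def extend_def split_beta'
    by (intro measurable_Pair measurable_fun_upd[OF 1(1)] measurable_fun_upd[OF 1(2)]) measurable
qed

lemma borel_if_nonneg_borel: "g \<in> A \<rightarrow>\<^sub>M nonneg_borel \<Longrightarrow> g \<in> borel_measurable A"
  by (simp add: measurable_restrict_space2_iff)

lemma nonneg_borelI:
  "g \<in> borel_measurable A \<Longrightarrow> (\<And>a. a \<in> space A \<Longrightarrow> 0 \<le> g a) \<Longrightarrow> g \<in> A \<rightarrow>\<^sub>M nonneg_borel"
  by (auto simp: measurable_restrict_space2_iff)

lemma stock_measurable:
  assumes X: "X \<in> A \<rightarrow>\<^sub>M inventories" and Q: "Q \<in> A \<rightarrow>\<^sub>M nonneg_borel" and "k < K"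
  shows "(\<lambda>a. stock (X a) (Q a) k) \<in> borel_measurable A"
proof (cases "k = 0")
  case True
  then show ?thesis using borel_if_nonneg_borel[OF Q] by (simp add: stock_def)
next
  case False
  then have "(\<lambda>a. X a k) \<in> A \<rightarrow>\<^sub>M nonneg_borel"
    using X assms(3) unfolding inventories_def
    by (intro measurable_compose[OF X[unfolded inventories_def] measurable_component_singleton]) auto
  then show ?thesis using False by (simp add: stock_def borel_if_nonneg_borel)
qed

lemma available_measurable:
  assumes "X \<in> A \<rightarrow>\<^sub>M inventories" "Q \<in> A \<rightarrow>\<^sub>M nonneg_borel"
  shows "(\<lambda>a. available (X a) (Q a)) \<in> borel_measurable A"
  unfolding available_eq_sum_stock
  by (intro borel_measurable_sum stock_measurable[OF assms]) simp

lemma issue_next_measurable: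
  assumes X: "X \<in> A \<rightarrow>\<^sub>M inventories" and Q: "Q \<in> A \<rightarrow>\<^sub>M nonneg_borel"
    and V: "\<And>k. k < K \<Longrightarrow> (\<lambda>a. V a k) \<in> borel_measurable A"
    and le: "\<And>k a. k < K \<Longrightarrow> a \<in> space A \<Longrightarrow> V a k \<le> stock (X a) (Q a) k"
  shows "(\<lambda>a. issue_next (V a) (X a) (Q a)) \<in> A \<rightarrow>\<^sub>M inventories"
  unfolding issue_next_def inventories_def
proof (intro measurable_restrict nonneg_borelI)
  fix k assume "k \<in> {1..<K}"
  then have k: "k - 1 < K" by auto
  show "(\<lambda>a. stock (X a) (Q a) (k - 1) - V a (k - 1)) \<in> borel_measurable A"
    by (intro borel_measurable_diff stock_measurable X Q V k)
  show "0 \<le> stock (X a) (Q a) (k - 1) - V a (k - 1)" if "a \<in> space A" for a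
    using le[OF k that] by simp
qed

lemma issue_next_space:
  "(\<And>k. k < K \<Longrightarrow> v k \<le> stock x q k) \<Longrightarrow> issue_next v x q \<in> space inventories"
  by (auto simp: issue_next_def inventories_def space_PiM space_restrict_space)

lemma fifo_next_space: "fifo_next x q d \<in> space inventories"
  by (auto simp: fifo_next_def inventories_def space_PiM space_restrict_space)

lemma fifo_measurable:
  assumes X: "X \<in> A \<rightarrow>\<^sub>M inventories" and Q: "Q \<in> A \<rightarrow>\<^sub>M nonneg_borel"
    and d: "d \<in> A \<rightarrow>\<^sub>M nonneg_borel" and k: "k < K"
  shows "(\<lambda>a. fifo t (X a) (F a) (Q a) (d a) k) \<in> borel_measurable A"
  unfolding fifo_def
  by (intro borel_measurable_min borel_measurable_max borel_measurable_const borel_measurable_diff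
      borel_measurable_sum stock_measurable[OF X Q] borel_if_nonneg_borel[OF d]) (use k in auto)

lemma fifo_next_measurable:
  assumes X: "X \<in> A \<rightarrow>\<^sub>M inventories" and Q: "Q \<in> A \<rightarrow>\<^sub>M nonneg_borel"
    and d: "d \<in> A \<rightarrow>\<^sub>M nonneg_borel"
  shows "(\<lambda>a. fifo_next (X a) (Q a) (d a)) \<in> A \<rightarrow>\<^sub>M inventories"
  unfolding fifo_next_eq_issue_next[of _ _ _ 0 undefined]
  by (intro issue_next_measurable X Q fifo_measurable d) (auto simp: fifo_def)

lemma issuing_policy_fifo: "issuing_policy fifo"
  unfolding issuing_policy_def
proof (intro ballI conjI allI impI)
  fix t k assume "k < K"
  then show "(\<lambda>(x, f, q, d). fifo t x f q d k)
      \<in> borel_measurable (inventories \<Otimes>\<^sub>M hist t \<Otimes>\<^sub>M nonneg_borel \<Otimes>\<^sub>M nonneg_borel)"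
    unfolding split_beta' by (intro fifo_measurable) measurable
next
  fix t x f and q d :: real
  assume "x \<in> space inventories" "0 \<le> q" "0 \<le> d"
  then show "(\<Sum>k<K. fifo t x f q d k) = min (available x q) d" by (rule sum_fifo)
  fix k assume "k < K"
  then show "0 \<le> fifo t x f q d k" "fifo t x f q d k \<le> stock x q k"
    using stock_nonneg[OF \<open>x \<in> space inventories\<close> \<open>0 \<le> q\<close>] by (auto simp: fifo_def)
qed

lemma issuing_policyD:
  assumes "issuing_policy v" "t \<in> {1..T}" "x \<in> space inventories" "f \<in> space (hist t)"
    "0 \<le> q" "0 \<le> d"
  shows "k < K \<Longrightarrow> 0 \<le> v t x f q d k \<and> v t x f q d k \<le> stock x q k"
    and "(\<Sum>k<K. v t x f q d k) = min (available x q) d"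
  using assms unfolding issuing_policy_def by blast+

lemma issuing_policy_measurable:
  assumes v: "issuing_policy v" "t \<in> {1..T}" and "X \<in> A \<rightarrow>\<^sub>M inventories" "F \<in> A \<rightarrow>\<^sub>M hist t"
    "Q \<in> A \<rightarrow>\<^sub>M nonneg_borel" "d \<in> A \<rightarrow>\<^sub>M nonneg_borel" and k: "k < K"
  shows "(\<lambda>a. v t (X a) (F a) (Q a) (d a) k) \<in> borel_measurable A"
proof -
  have "(\<lambda>(x, f, q, d). v t x f q d k)
      \<in> borel_measurable (inventories \<Otimes>\<^sub>M hist t \<Otimes>\<^sub>M nonneg_borel \<Otimes>\<^sub>M nonneg_borel)"
    using v k unfolding issuing_policy_def by blast
  from measurable_compose[OF _ this, of "\<lambda>a. (X a, F a, Q a, d a)"] show ?thesis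
    using assms(3-6) by simp
qed

lemma issuing_policy_next_measurable:
  assumes "issuing_policy v" "t \<in> {1..T}" "X \<in> A \<rightarrow>\<^sub>M inventories" "F \<in> A \<rightarrow>\<^sub>M hist t"
    "Q \<in> A \<rightarrow>\<^sub>M nonneg_borel" "d \<in> A \<rightarrow>\<^sub>M nonneg_borel"
  shows "(\<lambda>a. issue_next (v t (X a) (F a) (Q a) (d a)) (X a) (Q a)) \<in> A \<rightarrow>\<^sub>M inventories"
proof (intro issue_next_measurable assms(3,5) issuing_policy_measurable[OF assms])
  fix k a assume "k < K" "a \<in> space A"
  then show "v t (X a) (F a) (Q a) (d a) k \<le> stock (X a) (Q a) k"
    using assms(3-6)[THEN measurable_space]
    by (intro issuing_policyD(1)[OF assms(1,2), THEN conjunct2]) (auto simp: space_restrict_space)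
qed

section \<open>Kernels and the order cost as a single integral\<close>

lemma kernel:
  assumes "t \<in> {1..T}" "f \<in> space (hist t)"
  shows prob_space_kernel: "prob_space (\<kappa> t f)"
    and sets_kernel: "sets (\<kappa> t f) = sets (nonneg_borel \<Otimes>\<^sub>M N (Suc t))"
  using measurable_space[OF kernel_measurable[OF assms(1)] assms(2)]
  by (auto simp: space_prob_algebra)

lemma space_kernel:
  assumes "t \<in> {1..T}" "f \<in> space (hist t)"
  shows "space (\<kappa> t f) = {0..} \<times> space (N (Suc t))"
  using sets_eq_imp_space_eq[OF sets_kernel[OF assms]]
  by (simp add: space_pair_measure space_restrict_space)

lemma extend_space:
  assumes "t \<in> {1..T}" "f \<in> space (hist t)" "z \<in> space (\<kappa> t f)"
  shows "extend t f z \<in> space (hist (Suc t))"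
  using measurable_space[OF extend_measurable[of t], of "(f, z)"] assms space_kernel[OF assms(1,2)]
  by (simp add: space_pair_measure space_restrict_space)

lemma stage_cost_measurable:
  assumes X: "X \<in> A \<rightarrow>\<^sub>M inventories" and Q: "Q \<in> A \<rightarrow>\<^sub>M nonneg_borel"
    and d: "d \<in> A \<rightarrow>\<^sub>M nonneg_borel"
  shows "(\<lambda>a. stage_cost (X a) (Q a) (d a)) \<in> borel_measurable A"
  unfolding stage_cost_def
  by (intro borel_measurable_add borel_measurable_times borel_measurable_const borel_measurable_max
      borel_measurable_diff available_measurable[OF X Q] stock_measurable[OF X Q]
      borel_if_nonneg_borel[OF d]) (use lifetime in auto)

text \<open>With the four integrals collected into one, order costs can be compared pointwise in the
  demand. Measurability of \<open>V\<close> enters through additivity of the integral.\<close>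

lemma order_cost_eq:
  assumes t: "t \<in> {1..T}" and x: "x \<in> space inventories" and f: "f \<in> space (hist t)" and q: "0 \<le> q"
    and V: "(\<lambda>(x, f). V x f) \<in> borel_measurable (inventories \<Otimes>\<^sub>M hist (Suc t))"
  shows "order_cost t V x f q =
    (\<integral>\<^sup>+z. ennreal (stage_cost x q (fst z))
      + ennreal \<beta> * V (fifo_next x q (fst z)) (extend t f z) \<partial>\<kappa> t f)"
proof -
  let ?B = "nonneg_borel \<Otimes>\<^sub>M N (Suc t)"
  note [measurable_cong] = sets_kernel[OF t f]
  have fst[measurable]: "fst \<in> ?B \<rightarrow>\<^sub>M nonneg_borel" by measurable
  have [measurable]: "(\<lambda>z. fst z) \<in> borel_measurable ?B" by (rule borel_if_nonneg_borel) measurable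
  have next_inv: "(\<lambda>z. fifo_next x q (fst z)) \<in> ?B \<rightarrow>\<^sub>M inventories"
    by (rule fifo_next_measurable) (use x q in \<open>auto simp: space_restrict_space\<close>)
  have next_hist: "(\<lambda>z. extend t f z) \<in> ?B \<rightarrow>\<^sub>M hist (Suc t)"
    using measurable_compose[OF _ extend_measurable[of t], of "\<lambda>z. (f, z)" ?B] f t by simp
  have [measurable]: "(\<lambda>z. V (fifo_next x q (fst z)) (extend t f z)) \<in> borel_measurable ?B"
    using measurable_compose[OF measurable_Pair[OF next_inv next_hist] V] by simp
  have "ennreal (stage_cost x q d) = ennreal p * ennreal (max 0 (d - available x q))
      + ennreal h * ennreal (max 0 (available x q - d))
      + ennreal w * ennreal (max 0 (stock x q (K - 1) - d))" for d
    unfolding stage_cost_def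
    by (simp only: ennreal_plus ennreal_mult mult_nonneg_nonneg add_nonneg_nonneg max.cobounded1
        unit_costs)
  then show ?thesis
    unfolding order_cost_def split_beta'
    by (simp add: nn_integral_add nn_integral_cmult)
qed

section \<open>The conditional law of the sample path\<close>

lemma path_law_after_horizon: "path_law (Suc T) f = return (hist (Suc T)) f"
  by (simp add: path_law.simps)

text \<open>Backward induction from the horizon: each law is the bind of a measurable kernel with
  the law that starts from the extended history.\<close>

lemma path_law_measurable:
  assumes "1 \<le> t" "t \<le> Suc T"
  shows "path_law t \<in> hist t \<rightarrow>\<^sub>M prob_algebra (hist (Suc T))"
  using assms(2)
proof (induction rule: inc_induct)
  case base
  have "path_law (Suc T) = return (hist (Suc T))"
    by (rule ext) (rule path_law_after_horizon)
  then show ?case by (simp add: measurable_return_prob_space)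
next
  case (step n)
  have n: "n \<in> {1..T}" using step assms(1) by auto
  have "path_law n = (\<lambda>f. \<kappa> n f \<bind> (\<lambda>z. path_law (Suc n) (extend n f z)))"
    using n by (intro ext) (simp add: path_law.simps[of n])
  moreover have "(\<lambda>(f, z). path_law (Suc n) (extend n f z))
      \<in> hist n \<Otimes>\<^sub>M (nonneg_borel \<Otimes>\<^sub>M N (Suc n)) \<rightarrow>\<^sub>M prob_algebra (hist (Suc T))"
    using measurable_compose[OF extend_measurable step.IH] n by (simp add: split_beta')
  ultimately show ?case
    using measurable_bind_prob_space2[OF kernel_measurable[OF n]] by simp
qed

lemma path_law:
  assumes "1 \<le> t" "t \<le> Suc T" "f \<in> space (hist t)"
  shows prob_space_path_law: "prob_space (path_law t f)"
    and sets_path_law: "sets (path_law t f) = sets (hist (Suc T))"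
  using measurable_space[OF path_law_measurable assms(3)] assms(1,2)
  by (auto simp: space_prob_algebra)

text \<open>The tower property for the draw of period \<open>t\<close>, obtained from the integral
  with respect to a bind.\<close>

lemma nn_integral_path_law:
  assumes t: "t \<in> {1..T}" and f: "f \<in> space (hist t)" and G: "G \<in> borel_measurable (hist (Suc T))"
  shows "(\<integral>\<^sup>+g. G g \<partial>path_law t f) =
    (\<integral>\<^sup>+z. \<integral>\<^sup>+g. G g \<partial>path_law (Suc t) (extend t f z) \<partial>\<kappa> t f)"
proof -
  have "(\<lambda>z. extend t f z) \<in> nonneg_borel \<Otimes>\<^sub>M N (Suc t) \<rightarrow>\<^sub>M hist (Suc t)"
    using measurable_compose[OF _ extend_measurable[of t], of "\<lambda>z. (f, z)"] f t by simp
  from measurable_compose[OF this measurable_prob_algebraD[OF path_law_measurable]]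
  have "(\<lambda>z. path_law (Suc t) (extend t f z)) \<in> \<kappa> t f \<rightarrow>\<^sub>M subprob_algebra (hist (Suc T))"
    using t unfolding measurable_cong_sets[OF sets_kernel[OF t f] refl] by simp
  moreover have "path_law t f = \<kappa> t f \<bind> (\<lambda>z. path_law (Suc t) (extend t f z))"
    using t by (simp add: path_law.simps[of t])
  ultimately show ?thesis using nn_integral_bind[OF G] by simp
qed

text \<open>
  Points of \<open>hist t\<close> need not be measurable, so that \<open>history_upto t g = f\<close> for almost all \<open>g\<close> has
  to be replaced by a statement about integrals.
\<close>

lemma nn_integral_path_law_history_upto:
  assumes "1 \<le> t" "t \<le> Suc T" "f \<in> space (hist t)"
    and "(\<lambda>(f, g). G f g) \<in> borel_measurable (hist t \<Otimes>\<^sub>M hist (Suc T))"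
  shows "(\<integral>\<^sup>+g. G (history_upto t g) g \<partial>path_law t f) = (\<integral>\<^sup>+g. G f g \<partial>path_law t f)"
  using assms(2-)
proof (induction arbitrary: f G rule: inc_induct)
  case base
  have id: "history_upto (Suc T) \<in> hist (Suc T) \<rightarrow>\<^sub>M hist (Suc T)"
    by (rule history_upto_measurable) simp
  have "(\<lambda>g. G (history_upto (Suc T) g) g) \<in> borel_measurable (hist (Suc T))"
    using measurable_compose[OF measurable_Pair[OF id measurable_ident] base(2)] by simp
  moreover have "(\<lambda>g. G f g) \<in> borel_measurable (hist (Suc T))"
    using measurable_compose[OF measurable_Pair[OF measurable_const[OF base(1)] measurable_ident] base(2)]
    by simp
  ultimately show ?case
    using base(1) by (simp add: path_law_after_horizon nn_integral_return history_upto_ident)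
next
  case (step n)
  have n: "n \<in> {1..T}" using step.hyps assms(1) by auto
  have h: "history_upto n \<in> hist (Suc T) \<rightarrow>\<^sub>M hist n" "history_upto n \<in> hist (Suc n) \<rightarrow>\<^sub>M hist n"
    using n by (auto intro: history_upto_measurable)
  have m: "(\<lambda>g. G (history_upto n g) g) \<in> borel_measurable (hist (Suc T))"
    using measurable_compose[OF measurable_Pair[OF h(1) measurable_ident] step.prems(2)] by simp
  have m': "(\<lambda>g. G f g) \<in> borel_measurable (hist (Suc T))"
    using measurable_compose[OF measurable_Pair[OF measurable_const[OF step.prems(1)] measurable_ident]
        step.prems(2)]
    by simp
  \<comment> \<open>The induction hypothesis is applied to this integrand: truncation to
    \<open>n\<close> factors through truncation to \<open>Suc n\<close>, and truncating
    \<open>extend n f z\<close> to \<open>n\<close> gives back \<open>f\<close>.\<close>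
  have m'': "(\<lambda>(f', g). G (history_upto n f') g) \<in> borel_measurable (hist (Suc n) \<Otimes>\<^sub>M hist (Suc T))"
    using measurable_compose[OF measurable_Pair[OF measurable_compose[OF measurable_fst h(2)]
          measurable_snd] step.prems(2)]
    by (simp add: split_beta')
  have "(\<integral>\<^sup>+g. G (history_upto n g) g \<partial>path_law n f)
    = (\<integral>\<^sup>+z. \<integral>\<^sup>+g. G (history_upto n (history_upto (Suc n) g)) g \<partial>path_law (Suc n) (extend n f z) \<partial>\<kappa> n f)"
    using nn_integral_path_law[OF n step.prems(1) m] by (simp add: history_upto_upto)
  also have "\<dots> = (\<integral>\<^sup>+z. \<integral>\<^sup>+g. G f g \<partial>path_law (Suc n) (extend n f z) \<partial>\<kappa> n f)"
    using step.IH[OF extend_space[OF n step.prems(1)] m'']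
    by (intro nn_integral_cong[of "\<kappa> n f"]) (simp only: history_upto_extend[OF step.prems(1)])
  also have "\<dots> = (\<integral>\<^sup>+g. G f g \<partial>path_law n f)"
    using nn_integral_path_law[OF n step.prems(1) m'] by simp
  finally show ?case .
qed

section \<open>Costs along a path: recursion and measurability\<close>

definition issue_cost :: "'u issuing \<Rightarrow> nat \<Rightarrow> inventory \<Rightarrow> 'u history \<Rightarrow> real \<Rightarrow> real \<Rightarrow> real" where
  "issue_cost v t x f q d =
     p * max 0 (d - available x q) + h * max 0 (available x q - d)
   + w * (stock x q (K - 1) - v t x f q d (K - 1))"

abbreviation issued :: "'u issuing \<Rightarrow> nat \<Rightarrow> inventory \<Rightarrow> 'u history \<Rightarrow> real \<Rightarrow> real \<Rightarrow> inventory" where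
  "issued v t x f q d \<equiv> issue_next (v t x f q d) x q"

text \<open>The recursion of \<open>trajectory\<close> splits off the last period; backward
  induction needs the first one split off instead.\<close>

lemma trajectory_Suc_shift:
  "trajectory ord v t x q g (Suc n) =
    (let x' = issued v t x (history_upto t g) q (fst g t)
     in trajectory ord v (Suc t) x' (ord (Suc t) x' (history_upto (Suc t) g)) g n)"
  by (induction n) (simp_all add: Let_def split_beta')

lemma total_cost_Suc:
  assumes "t \<le> T" and x': "x' = issued v t x (history_upto t g) q (fst g t)"
  shows "total_cost ord v t x q g = issue_cost v t x (history_upto t g) q (fst g t)
    + \<beta> * total_cost ord v (Suc t) x' (ord (Suc t) x' (history_upto (Suc t) g)) g"
proof -
  have "\<beta> ^ (s - t) * period_cost v s g (trajectory ord v t x q g (s - t))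
    = \<beta> * (\<beta> ^ (s - Suc t) * period_cost v s g (trajectory ord v (Suc t) x'
        (ord (Suc t) x' (history_upto (Suc t) g)) g (s - Suc t)))" if "s \<in> {Suc t..T}" for s
  proof -
    have "s - t = Suc (s - Suc t)" using that by auto
    then show ?thesis by (simp only: trajectory_Suc_shift Let_def x' power_Suc mult.assoc)
  qed
  moreover have "period_cost v t g (x, q) = issue_cost v t x (history_upto t g) q (fst g t)"
    by (simp add: period_cost_def issue_cost_def)
  ultimately show ?thesis
    using assms(1) by (simp add: total_cost_def sum.atLeast_Suc_atMost sum_distrib_left)
qed

lemma total_cost_after_horizon: "total_cost ord v (Suc T) x q g = 0"
  by (simp add: total_cost_def)

lemma optimal_ordering_from_le:
  "optimal_ordering_from s ord \<Longrightarrow> s \<le> t \<Longrightarrow> optimal_ordering_from t ord"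
  by (auto simp: optimal_ordering_from_def)

lemma optimal_orderingD:
  assumes "optimal_ordering_from s ord" "s \<le> t" "t \<le> T" "x \<in> space inventories" "f \<in> space (hist t)"
  shows "0 \<le> ord t x f" "order_cost t (optimal_cost (Suc t)) x f (ord t x f) = optimal_cost t x f"
  using assms by (auto simp: optimal_ordering_from_def optimal_order_def)

lemma optimal_ordering_measurable:
  assumes ord: "optimal_ordering_from s ord" "s \<le> t" "t \<le> T"
    and X: "X \<in> A \<rightarrow>\<^sub>M inventories" and F: "F \<in> A \<rightarrow>\<^sub>M hist t"
  shows "(\<lambda>a. ord t (X a) (F a)) \<in> A \<rightarrow>\<^sub>M nonneg_borel"
proof (rule nonneg_borelI)
  have "(\<lambda>(x, f). ord t x f) \<in> borel_measurable (inventories \<Otimes>\<^sub>M hist t)"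
    using ord by (auto simp: optimal_ordering_from_def)
  from measurable_compose[OF measurable_Pair[OF X F] this]
  show "(\<lambda>a. ord t (X a) (F a)) \<in> borel_measurable A" by simp
  show "0 \<le> ord t (X a) (F a)" if "a \<in> space A" for a
    by (rule optimal_orderingD(1)[OF ord measurable_space[OF X that] measurable_space[OF F that]])
qed

lemma issue_cost_measurable:
  assumes "issuing_policy v" "t \<in> {1..T}" "X \<in> A \<rightarrow>\<^sub>M inventories" "F \<in> A \<rightarrow>\<^sub>M hist t"
    "Q \<in> A \<rightarrow>\<^sub>M nonneg_borel" "d \<in> A \<rightarrow>\<^sub>M nonneg_borel"
  shows "(\<lambda>a. issue_cost v t (X a) (F a) (Q a) (d a)) \<in> borel_measurable A"
  unfolding issue_cost_def
  by (intro borel_measurable_add borel_measurable_times borel_measurable_const borel_measurable_max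
      borel_measurable_diff available_measurable[OF assms(3,5)] stock_measurable[OF assms(3,5)]
      issuing_policy_measurable[OF assms] borel_if_nonneg_borel[OF assms(6)]) (use lifetime in auto)

lemma issue_cost_nonneg:
  assumes "issuing_policy v" "t \<in> {1..T}" "x \<in> space inventories" "f \<in> space (hist t)"
    "0 \<le> q" "0 \<le> d"
  shows "0 \<le> issue_cost v t x f q d"
  using issuing_policyD(1)[OF assms, of "K - 1"] lifetime unit_costs
  unfolding issue_cost_def by (intro add_nonneg_nonneg mult_nonneg_nonneg) auto

lemma issued_space:
  assumes "issuing_policy v" "t \<in> {1..T}" "x \<in> space inventories" "f \<in> space (hist t)"
    "0 \<le> q" "0 \<le> d"
  shows "issued v t x f q d \<in> space inventories"
  using issuing_policyD(1)[OF assms] by (intro issue_next_space) auto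

text \<open>The history \<open>F\<close> that determines the first order is kept separate from the
  path \<open>G\<close>, because the one-step recursion treats the extended history and the later
  path as two independent variables.\<close>

lemma total_cost_measurable:
  assumes v: "issuing_policy v" and ord: "optimal_ordering_from (Suc s) ord" "Suc s \<le> t" "t \<le> Suc T"
    and G: "G \<in> A \<rightarrow>\<^sub>M hist (Suc T)"
    and "X \<in> A \<rightarrow>\<^sub>M inventories" "F \<in> A \<rightarrow>\<^sub>M hist t"
  shows "(\<lambda>a. total_cost ord v t (X a) (ord t (X a) (F a)) (G a)) \<in> borel_measurable A"
  using ord(3) assms(6-)
proof (induction arbitrary: X F rule: inc_induct)
  case base
  then show ?case by (simp add: total_cost_after_horizon)
next
  case (step n)
  have n: "n \<in> {1..T}" "Suc s \<le> n" "n \<le> T" using step.hyps ord by auto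
  let ?Q = "\<lambda>a. ord n (X a) (F a)"
  let ?X = "\<lambda>a. issued v n (X a) (history_upto n (G a)) (?Q a) (fst (G a) n)"
  have Q: "?Q \<in> A \<rightarrow>\<^sub>M nonneg_borel"
    by (rule optimal_ordering_measurable[OF ord(1) n(2,3) step.prems])
  have hist: "(\<lambda>a. history_upto n (G a)) \<in> A \<rightarrow>\<^sub>M hist n"
    "(\<lambda>a. history_upto (Suc n) (G a)) \<in> A \<rightarrow>\<^sub>M hist (Suc n)"
    using n by (auto intro!: measurable_compose[OF G] history_upto_measurable)
  have d: "(\<lambda>a. fst (G a) n) \<in> A \<rightarrow>\<^sub>M nonneg_borel"
    using n by (intro measurable_compose[OF G demand_measurable_hist]) auto
  have X: "?X \<in> A \<rightarrow>\<^sub>M inventories"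
    by (rule issuing_policy_next_measurable[OF v n(1) step.prems(1) hist(1) Q d])
  show ?case
    unfolding total_cost_Suc[OF n(3) refl]
    by (intro borel_measurable_add borel_measurable_times borel_measurable_const
        issue_cost_measurable[OF v n(1) step.prems(1) hist(1) Q d] step.IH[OF X hist(2)])
qed

text \<open>Since \<open>ennreal\<close> maps negative reals to zero, nonnegativity is what makes
  \<open>expected_total_cost\<close> faithful and lets \<open>ennreal\<close> distribute over the
  sum of present and future costs.\<close>

lemma total_cost_nonneg:
  assumes v: "issuing_policy v" and ord: "optimal_ordering_from (Suc s) ord" "Suc s \<le> t" "t \<le> Suc T"
    and g: "g \<in> space (hist (Suc T))" and "x \<in> space inventories" "f \<in> space (hist t)"
  shows "0 \<le> total_cost ord v t x (ord t x f) g"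
  using ord(3) assms(6-)
proof (induction arbitrary: x f rule: inc_induct)
  case base
  then show ?case by (simp add: total_cost_after_horizon)
next
  case (step n)
  have n: "n \<in> {1..T}" "Suc s \<le> n" "n \<le> T" using step.hyps ord by auto
  have q: "0 \<le> ord n x f" by (rule optimal_orderingD(1)[OF ord(1) n(2,3) step.prems])
  have hist: "history_upto n g \<in> space (hist n)" "history_upto (Suc n) g \<in> space (hist (Suc n))"
    using n by (auto intro!: measurable_space[OF history_upto_measurable g])
  have d: "0 \<le> fst g n" using g n by (auto simp: space_hist)
  show ?case
    unfolding total_cost_Suc[OF n(3) refl]
    using discount issue_cost_nonneg[OF v n(1) step.prems(1) hist(1) q d]
      step.IH[OF issued_space[OF v n(1) step.prems(1) hist(1) q d] hist(2)]
    by simp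
qed

text \<open>The tower property splits off the draw \<open>z\<close> of period \<open>t\<close>. The
  history that the total cost reads off the path is then frozen to \<open>extend t f z\<close>, so
  that the first-period cost and the next state are constant in the inner integral.\<close>

lemma expected_total_cost_Suc:
  assumes v: "issuing_policy v" and ord: "optimal_ordering_from (Suc t) ord" and t: "t \<in> {1..T}"
    and x: "x \<in> space inventories" and f: "f \<in> space (hist t)" and q: "0 \<le> q"
  shows "expected_total_cost ord t x f q v =
    (\<integral>\<^sup>+z. ennreal (issue_cost v t x f q (fst z))
      + ennreal \<beta> * (let x' = issued v t x f q (fst z); f' = extend t f z
          in expected_total_cost ord (Suc t) x' f' (ord (Suc t) x' f') v) \<partial>\<kappa> t f)"
proof -
  define X where "X f' = issued v t x (history_upto t f') q (fst f' t)" for f'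
  \<comment> \<open>\<open>G\<close> separates the history \<open>f'\<close>, which fixes the
    first-period cost, the next state and the next order, from the full path \<open>g\<close>, as
    \<open>nn_integral_path_law_history_upto\<close> requires.\<close>
  define G where "G f' g = ennreal (issue_cost v t x (history_upto t f') q (fst f' t)
    + \<beta> * total_cost ord v (Suc t) (X f') (ord (Suc t) (X f') f') g)" for f' g
  have T: "Suc t \<le> Suc T" "1 \<le> Suc t" using t by auto
  let ?H = "hist (Suc t) \<Otimes>\<^sub>M hist (Suc T)"
  have Q: "(\<lambda>_. q) \<in> A \<rightarrow>\<^sub>M nonneg_borel" and X0: "(\<lambda>_. x) \<in> A \<rightarrow>\<^sub>M inventories" for A :: "'b measure"
    using x q by (auto simp: space_restrict_space)
  have hist: "(\<lambda>a. history_upto t (fst a)) \<in> ?H \<rightarrow>\<^sub>M hist t"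
    by (intro measurable_compose[OF measurable_fst] history_upto_measurable) simp
  have d: "(\<lambda>a. fst (fst a) t) \<in> ?H \<rightarrow>\<^sub>M nonneg_borel"
    using t by (intro measurable_compose[OF measurable_fst] demand_measurable_hist) auto
  have X: "(\<lambda>a. X (fst a)) \<in> ?H \<rightarrow>\<^sub>M inventories"
    unfolding X_def by (rule issuing_policy_next_measurable[OF v t X0 hist Q d])
  have G: "(\<lambda>(f', g). G f' g) \<in> borel_measurable ?H"
    unfolding G_def split_beta'
    by (intro measurable_compose[OF _ measurable_ennreal] borel_measurable_add borel_measurable_times
        borel_measurable_const issue_cost_measurable[OF v t X0 hist Q d]
        total_cost_measurable[OF v ord order.refl T(1) _ X]) measurable
  have eq: "ennreal (total_cost ord v t x q g) = G (history_upto (Suc t) g) g" for g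
  proof -
    \<comment> \<open>A history up to \<open>Suc t\<close> contains the demands with index below
      \<open>Suc t\<close>, hence still the demand of period \<open>t\<close>.\<close>
    have "fst (history_upto (Suc t) g) t = fst g t" using t by (simp add: history_upto_def)
    then show ?thesis
      using t by (simp add: G_def X_def total_cost_Suc history_upto_upto)
  qed
  have G': "(\<lambda>g. G (history_upto (Suc t) g) g) \<in> borel_measurable (hist (Suc T))"
    using measurable_compose[OF _ G, of "\<lambda>g. (history_upto (Suc t) g, g)"] history_upto_measurable[OF T(1)]
    by simp
  have "expected_total_cost ord t x f q v = (\<integral>\<^sup>+z. \<integral>\<^sup>+g. G (history_upto (Suc t) g) g
      \<partial>path_law (Suc t) (extend t f z) \<partial>\<kappa> t f)"
    unfolding expected_total_cost_def eq by (rule nn_integral_path_law[OF t f G'])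
  also have "\<dots> = (\<integral>\<^sup>+z. \<integral>\<^sup>+g. G (extend t f z) g \<partial>path_law (Suc t) (extend t f z) \<partial>\<kappa> t f)"
    by (intro nn_integral_cong nn_integral_path_law_history_upto T extend_space[OF t f] G)
  also have "\<dots> = (\<integral>\<^sup>+z. ennreal (issue_cost v t x f q (fst z))
      + ennreal \<beta> * (let x' = issued v t x f q (fst z); f' = extend t f z
          in expected_total_cost ord (Suc t) x' f' (ord (Suc t) x' f') v) \<partial>\<kappa> t f)"
  proof (intro nn_integral_cong)
    fix z assume z: "z \<in> space (\<kappa> t f)"
    define f' where "f' = extend t f z"
    define x' where "x' = issued v t x f q (fst z)"
    have f': "f' \<in> space (hist (Suc t))" unfolding f'_def by (rule extend_space[OF t f z])
    have dz: "0 \<le> fst z" using z space_kernel[OF t f] by auto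
    have x': "x' \<in> space inventories" unfolding x'_def by (rule issued_space[OF v t x f q dz])
    have X': "X f' = x'" "history_upto t f' = f" "fst f' t = fst z"
      using history_upto_extend[OF f, of z] by (simp_all add: X_def x'_def f'_def) (simp_all add: extend_def)
    interpret P: prob_space "path_law (Suc t) f'" by (rule prob_space_path_law[OF T(2,1) f'])
    note sets = sets_path_law[OF T(2,1) f']
    let ?C = "\<lambda>g. total_cost ord v (Suc t) x' (ord (Suc t) x' f') g"
    have C: "?C \<in> borel_measurable (path_law (Suc t) f')"
      unfolding measurable_cong_sets[OF sets refl]
      by (intro total_cost_measurable[OF v ord order.refl T(1)]) (use x' f' in auto)
    \<comment> \<open>Once the sum is split, the first-period cost is a constant and integrates to
      itself, as the path law has total mass one.\<close>
    have "G f' g = ennreal (issue_cost v t x f q (fst z)) + ennreal \<beta> * ennreal (?C g)"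
      if "g \<in> space (path_law (Suc t) f')" for g
    proof -
      have "0 \<le> ?C g"
        using that sets_eq_imp_space_eq[OF sets] total_cost_nonneg[OF v ord order.refl T(1) _ x' f'] by simp
      then show ?thesis
        using discount issue_cost_nonneg[OF v t x f q dz]
        by (simp add: G_def X' ennreal_plus ennreal_mult)
    qed
    then have "(\<integral>\<^sup>+g. G f' g \<partial>path_law (Suc t) f') =
        (\<integral>\<^sup>+g. ennreal (issue_cost v t x f q (fst z)) + ennreal \<beta> * ennreal (?C g) \<partial>path_law (Suc t) f')"
      by (intro nn_integral_cong) simp
    also have "\<dots> = ennreal (issue_cost v t x f q (fst z))
        + ennreal \<beta> * expected_total_cost ord (Suc t) x' f' (ord (Suc t) x' f') v"
      using C by (simp add: nn_integral_add nn_integral_cmult P.emeasure_space_1 expected_total_cost_def)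
    finally show "(\<integral>\<^sup>+g. G (extend t f z) g \<partial>path_law (Suc t) (extend t f z)) =
        ennreal (issue_cost v t x f q (fst z))
        + ennreal \<beta> * (let x' = issued v t x f q (fst z); f' = extend t f z
          in expected_total_cost ord (Suc t) x' f' (ord (Suc t) x' f') v)"
      by (simp add: Let_def f'_def x'_def)
  qed
  finally show ?thesis .
qed

text \<open>An infimum over uncountably many order quantities is not evidently measurable. Here the
  measurable ordering policy \<open>ord\<close> attains it, which makes the cost-to-go the integral
  of a measurable function with respect to the kernel.\<close>

lemma optimal_cost_measurable:
  assumes ord: "optimal_ordering_from s ord" "1 \<le> s" "s \<le> t" "t \<le> Suc T"
  shows "(\<lambda>(x, f). optimal_cost t x f) \<in> borel_measurable (inventories \<Otimes>\<^sub>M hist t)"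
  using ord(4)
proof (induction rule: inc_induct)
  case base
  then show ?case by (simp add: optimal_cost.simps)
next
  case (step n)
  have n: "n \<in> {1..T}" "s \<le> n" "n \<le> T" using step.hyps ord by auto
  let ?A = "inventories \<Otimes>\<^sub>M hist n"
  let ?B = "nonneg_borel \<Otimes>\<^sub>M N (Suc n)"
  have X: "(\<lambda>a. fst (fst a)) \<in> ?A \<Otimes>\<^sub>M ?B \<rightarrow>\<^sub>M inventories"
    and F: "(\<lambda>a. snd (fst a)) \<in> ?A \<Otimes>\<^sub>M ?B \<rightarrow>\<^sub>M hist n"
    and d: "(\<lambda>a. fst (snd a)) \<in> ?A \<Otimes>\<^sub>M ?B \<rightarrow>\<^sub>M nonneg_borel"
    by measurable
  have Q: "(\<lambda>a. ord n (fst (fst a)) (snd (fst a))) \<in> ?A \<Otimes>\<^sub>M ?B \<rightarrow>\<^sub>M nonneg_borel"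
    by (rule optimal_ordering_measurable[OF ord(1) n(2,3) X F])
  have "(\<lambda>a. extend n (snd (fst a)) (snd a)) \<in> ?A \<Otimes>\<^sub>M ?B \<rightarrow>\<^sub>M hist (Suc n)"
    using measurable_compose[OF measurable_Pair[OF F measurable_snd] extend_measurable[of n]] n by simp
  from measurable_compose[OF measurable_Pair[OF fifo_next_measurable[OF X Q d] this] step.IH]
  have "(\<lambda>(a, z). ennreal (stage_cost (fst a) (ord n (fst a) (snd a)) (fst z)) + ennreal \<beta> *
      optimal_cost (Suc n) (fifo_next (fst a) (ord n (fst a) (snd a)) (fst z)) (extend n (snd a) z))
      \<in> borel_measurable (?A \<Otimes>\<^sub>M ?B)"
    unfolding split_beta'
    by (intro borel_measurable_add borel_measurable_times_ennreal borel_measurable_const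
        measurable_compose[OF stage_cost_measurable[OF X Q d] measurable_ennreal]) simp
  moreover have "(\<lambda>a. \<kappa> n (snd a)) \<in> ?A \<rightarrow>\<^sub>M subprob_algebra ?B"
    by (intro measurable_prob_algebraD measurable_compose[OF measurable_snd kernel_measurable[OF n(1)]])
  ultimately have m: "(\<lambda>a. \<integral>\<^sup>+z. ennreal (stage_cost (fst a) (ord n (fst a) (snd a)) (fst z)) + ennreal \<beta> *
      optimal_cost (Suc n) (fifo_next (fst a) (ord n (fst a) (snd a)) (fst z)) (extend n (snd a) z)
      \<partial>\<kappa> n (snd a)) \<in> borel_measurable ?A"
    by (rule nn_integral_measurable_subprob_algebra2)
  have "optimal_cost n (fst a) (snd a) =
      (\<integral>\<^sup>+z. ennreal (stage_cost (fst a) (ord n (fst a) (snd a)) (fst z)) + ennreal \<beta> *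
      optimal_cost (Suc n) (fifo_next (fst a) (ord n (fst a) (snd a)) (fst z)) (extend n (snd a) z)
      \<partial>\<kappa> n (snd a))" if "a \<in> space ?A" for a
  proof -
    have a: "fst a \<in> space inventories" "snd a \<in> space (hist n)"
      using that by (auto simp: space_pair_measure)
    note opt = optimal_orderingD[OF ord(1) n(2,3) a]
    show ?thesis
      using order_cost_eq[OF n(1) a opt(1) step.IH] opt(2) by simp
  qed
  then show ?case
    unfolding split_beta' by (subst measurable_cong) (use m in auto)
qed

section \<open>Sensitivity of the optimal cost-to-go to excess stock\<close>

lemma optimal_cost_le_order_cost:
  "t \<le> T \<Longrightarrow> 0 \<le> q \<Longrightarrow> optimal_cost t x f \<le> order_cost t (optimal_cost (Suc t)) x f q"
  by (subst optimal_cost.simps) (auto intro: INF_lower)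

text \<open>The accounting common to both comparisons: an excess \<open>\<delta>\<close> in the next
  state raises the future cost by at most \<open>w / \<beta>\<close> per unit, hence by
  \<open>w\<close> per unit after discounting, and the gap between \<open>c\<close> and
  \<open>c'\<close> pays for it.\<close>

lemma discounted_cost_mono:
  fixes V V' :: ennreal
  assumes "V \<le> V' + ennreal (w / \<beta> * \<delta>)" "0 \<le> \<delta>" "0 \<le> c" "c + w * \<delta> \<le> c'"
  shows "ennreal c + ennreal \<beta> * V \<le> ennreal c' + ennreal \<beta> * V'"
proof -
  have "ennreal \<beta> * V \<le> ennreal \<beta> * (V' + ennreal (w / \<beta> * \<delta>))"
    by (intro mult_left_mono assms) simp
  also have "\<dots> = ennreal \<beta> * V' + ennreal (w * \<delta>)"
    using discount unit_costs assms(2) by (simp add: distrib_left ennreal_mult[symmetric])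
  finally have "ennreal c + ennreal \<beta> * V \<le> ennreal c + (ennreal \<beta> * V' + ennreal (w * \<delta>))"
    by (intro add_left_mono)
  also have "\<dots> = ennreal (c + w * \<delta>) + ennreal \<beta> * V'"
    using assms unit_costs by (simp add: ac_simps)
  also have "\<dots> \<le> ennreal c' + ennreal \<beta> * V'"
    by (intro add_right_mono ennreal_leI assms)
  finally show ?thesis .
qed

text \<open>Backward induction: under equal orders and FIFO, dominance persists, and by
  \<open>younger_stage_cost\<close> the rate \<open>w / \<beta>\<close> reproduces itself from one
  period to the one before.\<close>

lemma optimal_cost_younger:
  assumes hw: "h + w \<le> w / \<beta>"
    and ord: "optimal_ordering_from s ord" "1 \<le> s" "s \<le> t" "t \<le> Suc T"
    and "younger x x'" "x \<in> space inventories" "x' \<in> space inventories" "f \<in> space (hist t)"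
  shows "optimal_cost t x f \<le> optimal_cost t x' f + ennreal (w / \<beta> * (total x - total x'))"
  using ord(4) assms(6-)
proof (induction arbitrary: x x' f rule: inc_induct)
  case base
  then show ?case by (simp add: optimal_cost.simps)
next
  case (step n)
  have n: "n \<in> {1..T}" "s \<le> n" "n \<le> T" using step.hyps ord by auto
  note x = step.prems(2) and x' = step.prems(3) and f = step.prems(4)
  define r where "r = w / \<beta> * (total x - total x')"
  have r: "0 \<le> r" using younger_total[OF step.prems(1)] unit_costs discount by (simp add: r_def)
  \<comment> \<open>The order that is optimal at \<open>x'\<close> is copied at \<open>x\<close>. It
    need not be optimal there, but it bounds the cost at \<open>x\<close> from above and keeps the
    two states comparable.\<close>
  define q where "q = ord n x' f"
  note opt = optimal_orderingD[OF ord(1) n(2,3) x' f, folded q_def]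
  note eq = order_cost_eq[OF n(1) _ f opt(1) optimal_cost_measurable[OF ord(1,2)]]
  interpret P: prob_space "\<kappa> n f" by (rule prob_space_kernel[OF n(1) f])
  let ?V = "\<lambda>x z. optimal_cost (Suc n) (fifo_next x q (fst z)) (extend n f z)"
  have meas: "(\<lambda>z. ennreal (stage_cost x' q (fst z)) + ennreal \<beta> * ?V x' z) \<in> borel_measurable (\<kappa> n f)"
  proof -
    have X: "(\<lambda>_. x') \<in> \<kappa> n f \<rightarrow>\<^sub>M inventories" and Q: "(\<lambda>_. q) \<in> \<kappa> n f \<rightarrow>\<^sub>M nonneg_borel"
      using x' opt(1) by (auto simp: space_restrict_space)
    have d: "(\<lambda>z. fst z) \<in> \<kappa> n f \<rightarrow>\<^sub>M nonneg_borel"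
      and "(\<lambda>z. extend n f z) \<in> \<kappa> n f \<rightarrow>\<^sub>M hist (Suc n)"
      unfolding measurable_cong_sets[OF sets_kernel[OF n(1) f] refl]
      using measurable_compose[OF measurable_Pair1'[OF f] extend_measurable[of n]] n by simp_all
    from measurable_compose[OF measurable_Pair[OF fifo_next_measurable[OF X Q d] this(2)]
        optimal_cost_measurable[OF ord(1,2)]]
    show ?thesis
      using n by (intro borel_measurable_add borel_measurable_times_ennreal borel_measurable_const
        measurable_compose[OF stage_cost_measurable[OF X Q d] measurable_ennreal]) simp
  qed
  have "optimal_cost n x f \<le> order_cost n (optimal_cost (Suc n)) x f q"
    by (rule optimal_cost_le_order_cost[OF n(3) opt(1)])
  also have "\<dots> = (\<integral>\<^sup>+z. ennreal (stage_cost x q (fst z)) + ennreal \<beta> * ?V x z \<partial>\<kappa> n f)"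
    using n by (intro eq x) auto
  also have "\<dots> \<le> (\<integral>\<^sup>+z. (ennreal (stage_cost x' q (fst z)) + ennreal \<beta> * ?V x' z) + ennreal r \<partial>\<kappa> n f)"
  proof (rule nn_integral_mono)
    fix z assume z: "z \<in> space (\<kappa> n f)"
    have d: "0 \<le> fst z" using z space_kernel[OF n(1) f] by auto
    have y: "younger (fifo_next x q (fst z)) (fifo_next x' q (fst z))"
      by (rule younger_fifo_next[OF step.prems(1) x x' opt(1)])
    have "ennreal (stage_cost x q (fst z)) + ennreal \<beta> * ?V x z
        \<le> ennreal (stage_cost x' q (fst z) + r) + ennreal \<beta> * ?V x' z"
      using younger_stage_cost[OF step.prems(1) x x' opt(1) d hw] younger_total[OF y]
      by (intro discounted_cost_mono[OF step.IH[OF y fifo_next_space fifo_next_space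
              extend_space[OF n(1) f z]]] stage_cost_nonneg) (auto simp: r_def)
    also have "\<dots> = (ennreal (stage_cost x' q (fst z)) + ennreal \<beta> * ?V x' z) + ennreal r"
      using r stage_cost_nonneg by (simp add: ac_simps)
    finally show "ennreal (stage_cost x q (fst z)) + ennreal \<beta> * ?V x z
        \<le> (ennreal (stage_cost x' q (fst z)) + ennreal \<beta> * ?V x' z) + ennreal r" .
  qed
  \<comment> \<open>The bound \<open>r\<close> does not depend on the demand, and the kernel has
    total mass one.\<close>
  also have "\<dots> = (\<integral>\<^sup>+z. ennreal (stage_cost x' q (fst z)) + ennreal \<beta> * ?V x' z \<partial>\<kappa> n f) + ennreal r"
    using nn_integral_add[OF meas, of "\<lambda>_. ennreal r"] by (simp add: P.emeasure_space_1)
  also have "(\<integral>\<^sup>+z. ennreal (stage_cost x' q (fst z)) + ennreal \<beta> * ?V x' z \<partial>\<kappa> n f)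
      = order_cost n (optimal_cost (Suc n)) x' f q"
    using n by (intro eq[symmetric] x') auto
  finally show ?case by (simp add: opt(2) r_def)
qed

section \<open>Comparison of issuing policies with the optimal cost-to-go\<close>

lemma order_cost_le_expected_total_cost:
  assumes hw: "h + w \<le> w / \<beta>" and v: "issuing_policy v"
    and ord: "optimal_ordering_from (Suc t) ord" and t: "t \<in> {1..T}"
    and x: "x \<in> space inventories" and f: "f \<in> space (hist t)" and q: "0 \<le> q"
    and le: "\<And>x f. x \<in> space inventories \<Longrightarrow> f \<in> space (hist (Suc t)) \<Longrightarrow>
      optimal_cost (Suc t) x f \<le> expected_total_cost ord (Suc t) x f (ord (Suc t) x f) v"
  shows "order_cost t (optimal_cost (Suc t)) x f q \<le> expected_total_cost ord t x f q v"
proof -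
  have T: "1 \<le> Suc t" "Suc t \<le> Suc T" using t by auto
  note m = optimal_cost_measurable[OF ord T(1) order.refl T(2)]
  show ?thesis
    unfolding order_cost_eq[OF t x f q m] expected_total_cost_Suc[OF v ord t x f q] Let_def
  proof (rule nn_integral_mono)
    fix z assume z: "z \<in> space (\<kappa> t f)"
    let ?d = "fst z" and ?f = "extend t f z"
    let ?x = "issued v t x f q ?d"
    have d: "0 \<le> ?d" using z space_kernel[OF t f] by auto
    have x': "?x \<in> space inventories" by (rule issued_space[OF v t x f q d])
    have f': "?f \<in> space (hist (Suc t))" by (rule extend_space[OF t f z])
    note vD = issuing_policyD[OF v t x f q d]
    have y: "younger (fifo_next x q ?d) ?x"
      by (rule fifo_next_younger_issue_next[OF x q vD])
    \<comment> \<open>Replacing \<open>v\<close> by FIFO in this period saves \<open>w\<close> in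
      outdating per unit of excess stock carried over, which covers the discounted rise of the
      cost-to-go.\<close>
    have "ennreal (stage_cost x q ?d) + ennreal \<beta> * optimal_cost (Suc t) (fifo_next x q ?d) ?f
        \<le> ennreal (issue_cost v t x f q ?d) + ennreal \<beta> * optimal_cost (Suc t) ?x ?f"
      using younger_total[OF y] stage_cost_plus_excess[OF x q d vD(2)]
      by (intro discounted_cost_mono[OF optimal_cost_younger[OF hw ord T(1) order.refl T(2) y
              fifo_next_space x' f']] stage_cost_nonneg) (auto simp: issue_cost_def)
    \<comment> \<open>From the next period on, \<open>v\<close> is compared with the optimal
      cost-to-go by the assumption \<open>le\<close>.\<close>
    also have "\<dots> \<le> ennreal (issue_cost v t x f q ?d)
        + ennreal \<beta> * expected_total_cost ord (Suc t) ?x ?f (ord (Suc t) ?x ?f) v"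
      by (intro add_left_mono mult_left_mono le x' f') simp
    finally show "ennreal (stage_cost x q ?d) + ennreal \<beta> * optimal_cost (Suc t) (fifo_next x q ?d) ?f
        \<le> ennreal (issue_cost v t x f q ?d)
        + ennreal \<beta> * expected_total_cost ord (Suc t) ?x ?f (ord (Suc t) ?x ?f) v" .
  qed
qed

text \<open>For FIFO the outdated units and the next state are those of \<open>order_cost\<close>,
  so evaluating the policy and the dynamic program follow the same recursion.\<close>

lemma order_cost_eq_expected_total_cost_fifo:
  assumes ord: "optimal_ordering_from (Suc t) ord" and t: "t \<in> {1..T}"
    and x: "x \<in> space inventories" and f: "f \<in> space (hist t)" and q: "0 \<le> q"
    and eq: "\<And>x f. x \<in> space inventories \<Longrightarrow> f \<in> space (hist (Suc t)) \<Longrightarrow>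
      optimal_cost (Suc t) x f = expected_total_cost ord (Suc t) x f (ord (Suc t) x f) fifo"
  shows "order_cost t (optimal_cost (Suc t)) x f q = expected_total_cost ord t x f q fifo"
proof -
  have T: "1 \<le> Suc t" "Suc t \<le> Suc T" using t by auto
  note m = optimal_cost_measurable[OF ord T(1) order.refl T(2)]
  show ?thesis
    unfolding order_cost_eq[OF t x f q m] expected_total_cost_Suc[OF issuing_policy_fifo ord t x f q] Let_def
  proof (rule nn_integral_cong)
    fix z assume z: "z \<in> space (\<kappa> t f)"
    have d: "0 \<le> fst z" using z space_kernel[OF t f] by auto
    have "issue_cost fifo t x f q (fst z) = stage_cost x q (fst z)"
      unfolding issue_cost_def stage_cost_def fifo_oldest[OF d] ..
    then show "ennreal (stage_cost x q (fst z))
        + ennreal \<beta> * optimal_cost (Suc t) (fifo_next x q (fst z)) (extend t f z)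
      = ennreal (issue_cost fifo t x f q (fst z)) + ennreal \<beta> *
          expected_total_cost ord (Suc t) (issued fifo t x f q (fst z)) (extend t f z)
            (ord (Suc t) (issued fifo t x f q (fst z)) (extend t f z)) fifo"
      by (simp only: eq[OF fifo_next_space extend_space[OF t f z]]
          fifo_next_eq_issue_next[of x q "fst z" t f, symmetric])
  qed
qed

text \<open>With the order of period \<open>t\<close> also taken from \<open>ord\<close>, the order
  cost equals the optimal cost-to-go, so the one-period comparison can be iterated backwards from
  the horizon.\<close>

lemma optimal_cost_le_expected_total_cost:
  assumes hw: "h + w \<le> w / \<beta>" and v: "issuing_policy v"
    and ord: "optimal_ordering_from s ord" "1 \<le> s" "s \<le> t" "t \<le> Suc T"
    and "x \<in> space inventories" "f \<in> space (hist t)"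
  shows "optimal_cost t x f \<le> expected_total_cost ord t x f (ord t x f) v"
  using ord(4) assms(7-)
proof (induction arbitrary: x f rule: inc_induct)
  case base
  then show ?case by (simp add: optimal_cost.simps)
next
  case (step n)
  have n: "n \<in> {1..T}" "s \<le> n" "n \<le> T" "s \<le> Suc n" using step.hyps ord by auto
  note opt = optimal_orderingD[OF ord(1) n(2,3) step.prems]
  show ?case
    using order_cost_le_expected_total_cost[OF hw v optimal_ordering_from_le[OF ord(1) n(4)] n(1)
        step.prems opt(1) step.IH] opt(2) by simp
qed

lemma optimal_cost_eq_expected_total_cost_fifo:
  assumes ord: "optimal_ordering_from s ord" "1 \<le> s" "s \<le> t" "t \<le> Suc T"
    and "x \<in> space inventories" "f \<in> space (hist t)"
  shows "optimal_cost t x f = expected_total_cost ord t x f (ord t x f) fifo"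
  using ord(4) assms(5-)
proof (induction arbitrary: x f rule: inc_induct)
  case base
  then show ?case by (simp add: optimal_cost.simps expected_total_cost_def total_cost_after_horizon)
next
  case (step n)
  have n: "n \<in> {1..T}" "s \<le> n" "n \<le> T" "s \<le> Suc n" using step.hyps ord by auto
  note opt = optimal_orderingD[OF ord(1) n(2,3) step.prems]
  show ?case
    using order_cost_eq_expected_total_cost_fifo[OF optimal_ordering_from_le[OF ord(1) n(4)] n(1)
        step.prems opt(1) step.IH] opt(2) by simp
qed

text \<open>As \<open>q\<close> is not assumed optimal in period \<open>t\<close>, the value placed
  between the two policies is the order cost at \<open>q\<close>: it bounds the cost of
  \<open>v\<close> from below and equals the cost of FIFO.\<close>

lemma fifo_is_arg_min:
  assumes hw: "h + w \<le> w / \<beta>" and ord: "optimal_ordering_from (Suc t) ord" and t: "t \<in> {1..T}"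
    and x: "x \<in> space inventories" and f: "f \<in> space (hist t)" and q: "0 \<le> q"
  shows "is_arg_min (expected_total_cost ord t x f q) issuing_policy fifo"
  unfolding is_arg_min_def not_ex
proof (intro conjI allI issuing_policy_fifo)
  fix v
  have T: "1 \<le> Suc t" "Suc t \<le> Suc T" using t by auto
  have "expected_total_cost ord t x f q fifo \<le> expected_total_cost ord t x f q v" if "issuing_policy v"
    using order_cost_le_expected_total_cost[OF hw that ord t x f q
        optimal_cost_le_expected_total_cost[OF hw that ord T(1) order.refl T(2)]]
      order_cost_eq_expected_total_cost_fifo[OF ord t x f q
        optimal_cost_eq_expected_total_cost_fifo[OF ord T(1) order.refl T(2)]]
    by simp
  then show "\<not> (issuing_policy v \<and>
      expected_total_cost ord t x f q v < expected_total_cost ord t x f q fifo)"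
    by (auto simp: not_less)
qed

end

theorem proposition4:
  fixes M :: "'a measure" and N :: "nat \<Rightarrow> 'u measure"
    and K T :: nat and \<beta> p h w :: real
    and D :: "nat \<Rightarrow> 'a \<Rightarrow> real" and U :: "nat \<Rightarrow> 'a \<Rightarrow> 'u"
    and \<kappa> :: "nat \<Rightarrow> 'u history \<Rightarrow> (real \<times> 'u) measure"
  assumes "perishable_inventory M N K T \<beta> p h w D U \<kappa>"
    and "h \<le> (1 - \<beta>) / \<beta> * w"
  shows "perishable_inventory.fifo_optimality N K T \<beta> p h w \<kappa>"
proof -
  interpret perishable_inventory M N K T \<beta> p h w D U \<kappa> by fact
  \<comment> \<open>Adding \<open>w\<close> to both sides of the hypothesis bounds the cost
    \<open>h + w\<close> per unit of excess stock by the rate \<open>w / \<beta>\<close> of the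
    cost-to-go.\<close>
  have "(1 - \<beta>) / \<beta> * w + w = w / \<beta>"
    using discount by (simp add: field_simps)
  then have "h + w \<le> w / \<beta>" using assms(2) by linarith
  then show ?thesis
    unfolding fifo_optimality_def by (blast intro: fifo_is_arg_min)
qed

end
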